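(* Let $p$ be a prime, let $\emptyset\neq U\subseteq\mathbb{Z}_p\setminus\{0\}$ with $U\neq\mathbb{Z}_p\setminus\{0\}$, and let $g_0,g_1\in\mathbb{Z}_p$ with $g_0\neq g_1$. Let $\mathcal{C}=\{\{g_0\},\{g_1\},\mathbb{Z}_p\setminus\{g_0,g_1\}\}$ be the coloring in which the vertices $g_0$ and $g_1$ are individualized. Then $\mathrm{CR}_U^*(\mathcal{C})=\{\{g\}: g\in\mathbb{Z}_p\}$, i.e. every vertex gets a unique color.
   Context: The Cayley graph $\mathrm{Cay}(\mathbb{Z}_p,U)$ has vertex set $\mathbb{Z}_p$ and directed edges $(g,g+u)$ for $g\in\mathbb{Z}_p$, $u\in U$. For a partition (vertex coloring) $\mathcal{C}$ of $\mathbb{Z}_p$, let $\mathcal{C}(g)$ denote the part containing $g$. One step of Color Refinement yields the partition $\mathrm{CR}_U(\mathcal{C})$ in which $g,g'$ lie in the same part iff $\mathcal{C}(g)=\mathcal{C}(g')$ and the multisets of colors of in-neighbors $\{\{\mathcal{C}(g-u): u\in U\}\}$ and $\{\{\mathcal{C}(g'-u): u\in U\}\}$ are equal. $\mathrm{CR}_U^*(\mathcal{C})$ is the partition obtained by iterating $\mathrm{CR}_U$ starting from $\mathcal{C}$ until it stabilizes. *)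

theory Defs
  imports
    "HOL-Number_Theory.Number_Theory"
    "HOL-Library.Multiset"
    "HOL-Library.While_Combinator"
begin

abbreviation Zmod :: "nat \<Rightarrow> int ring" where
  "Zmod p \<equiv> residue_ring (int p)"

definition cayley_arcs :: "nat \<Rightarrow> int set \<Rightarrow> (int \<times> int) set" where
  "cayley_arcs p U = {(g, g \<oplus>\<^bsub>Zmod p\<^esub> u) | g u. g \<in> carrier (Zmod p) \<and> u \<in> U}"

text \<open>Vertex colorings are represented by their partitions into color classes, a color being
  the class itself; \<open>cell C g\<close> is meaningful only if exactly one member of \<open>C\<close> contains \<open>g\<close>.\<close>

definition cell :: "'a set set \<Rightarrow> 'a \<Rightarrow> 'a set" where
  "cell C g = (THE A. A \<in> C \<and> g \<in> A)"

text \<open>\<open>U\<close> is finite wherever this is used, so \<open>mset_set U\<close> lists each element of \<open>U\<close> once.\<close>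

definition in_colors :: "nat \<Rightarrow> int set \<Rightarrow> int set set \<Rightarrow> int \<Rightarrow> int set multiset" where
  "in_colors p U C g = image_mset (\<lambda>u. cell C (g \<ominus>\<^bsub>Zmod p\<^esub> u)) (mset_set U)"

definition CR :: "nat \<Rightarrow> int set \<Rightarrow> int set set \<Rightarrow> int set set" where
  "CR p U C = carrier (Zmod p) //
     {(g, g'). g \<in> carrier (Zmod p) \<and> g' \<in> carrier (Zmod p) \<and>
               cell C g = cell C g' \<and> in_colors p U C g = in_colors p U C g'}"

definition CR_star :: "nat \<Rightarrow> int set \<Rightarrow> int set set \<Rightarrow> int set set" where
  "CR_star p U C = while (\<lambda>D. CR p U D \<noteq> D) (CR p U) C"

text \<open>The elements \<open>g - u\<close> occurring in \<open>in_colors\<close> are pairwise distinct and are exactly the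
  in-neighbors of \<open>g\<close> in the Cayley graph.\<close>

lemma in_neighbors_cayley:
  assumes "prime p" "U \<subseteq> carrier (Zmod p)" "g \<in> carrier (Zmod p)"
  shows "bij_betw (\<lambda>u. g \<ominus>\<^bsub>Zmod p\<^esub> u) U {h. (h, g) \<in> cayley_arcs p U}"
proof -
  interpret residues "int p" "Zmod p"
    using prime_gt_1_nat[OF assms(1)] by unfold_locales auto
  have sub: "u \<in> carrier (Zmod p)" if "u \<in> U" for u
    using assms(2) that by blast
  have cancel: "(g \<ominus>\<^bsub>Zmod p\<^esub> u) \<oplus>\<^bsub>Zmod p\<^esub> u = g" if "u \<in> U" for u
    using sub[OF that] assms(3) by (simp add: a_minus_def a_assoc l_neg)
  have recover: "(h \<oplus>\<^bsub>Zmod p\<^esub> u) \<ominus>\<^bsub>Zmod p\<^esub> u = h" if "u \<in> U" "h \<in> carrier (Zmod p)" for h u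
    using sub[OF that(1)] that(2) by (simp add: a_minus_def a_assoc r_neg)
  have "inj_on (\<lambda>u. g \<ominus>\<^bsub>Zmod p\<^esub> u) U"
  proof (rule inj_onI)
    fix u v assume uv: "u \<in> U" "v \<in> U" "g \<ominus>\<^bsub>Zmod p\<^esub> u = g \<ominus>\<^bsub>Zmod p\<^esub> v"
    let ?h = "g \<ominus>\<^bsub>Zmod p\<^esub> u"
    have h: "?h \<in> carrier (Zmod p)"
      using sub[OF uv(1)] assms(3) by (rule minus_closed[rotated])
    have "?h \<oplus>\<^bsub>Zmod p\<^esub> u = ?h \<oplus>\<^bsub>Zmod p\<^esub> v"
      using cancel[OF uv(1)] cancel[OF uv(2)] uv(3) by metis
    then show "u = v"
      using h sub[OF uv(1)] sub[OF uv(2)] by (metis r_neg1)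
  qed
  moreover have "(\<lambda>u. g \<ominus>\<^bsub>Zmod p\<^esub> u) ` U = {h. (h, g) \<in> cayley_arcs p U}" (is "?L = ?R")
  proof (intro subset_antisym subsetI)
    fix h assume "h \<in> ?L"
    then obtain u where u: "u \<in> U" "h = g \<ominus>\<^bsub>Zmod p\<^esub> u" by blast
    have "h \<in> carrier (Zmod p)"
      unfolding u(2) using sub[OF u(1)] assms(3) by (rule minus_closed[rotated])
    moreover have "g = h \<oplus>\<^bsub>Zmod p\<^esub> u" using cancel[OF u(1)] u(2) by simp
    ultimately show "h \<in> ?R" using u(1) unfolding cayley_arcs_def by blast
  next
    fix h assume "h \<in> ?R"
    then obtain u where "u \<in> U" "h \<in> carrier (Zmod p)" "g = h \<oplus>\<^bsub>Zmod p\<^esub> u"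
      unfolding cayley_arcs_def by blast
    then show "h \<in> ?L" using recover by (metis imageI)
  qed
  ultimately show ?thesis by (simp add: bij_betw_def)
qed

end

theory Submission
  imports Defs "HOL-Computational_Algebra.Polynomial"
begin

text \<open>
  View colors as constraints on functions \<open>\<int>/p \<rightarrow> \<int>/p\<close>. Every such function is a polynomial of
  degree less than \<open>p\<close>, and those that are constant on the cells of a partition form an algebra.
  If some function in this algebra has degree 1, it is injective, so all cells are singletons.
  The proof finds such a function by tracking which degrees occur.

  If the partition is stable, the algebra is invariant under the operator
  \<open>f \<mapsto> (x \<mapsto> \<Sum>u\<in>U. f (x - u))\<close>. Expanding \<open>f (x - u)\<close> in powers of \<open>u\<close> shows that this operator is
  multiplication by \<open>|U|\<close> plus an operator which lowers degrees, by exactly \<open>r\<close>, where \<open>r\<close> is the least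
  positive exponent for which the power sum \<open>\<Sum>u\<in>U. u ^ r\<close> does not vanish modulo \<open>p\<close>
  (\<open>color_degrees_lower\<close>). The point is that \<open>2 * r \<le> p - 1\<close>
  (\<open>ex_small_power_sum_not_dvd\<close>): one of \<open>U\<close> and its complement \<open>V\<close> in the nonzero residues has
  at most \<open>(p - 1) / 2\<close> elements, a nonempty set of \<open>m\<close> nonzero residues has a nonvanishing power sum
  among the first \<open>m\<close>, and for exponents strictly between 0 and \<open>p - 1\<close> the power sums of \<open>U\<close>
  and \<open>V\<close> agree up to sign.

  Two individualized vertices \<open>g0\<close> and \<open>g1\<close> supply the degree \<open>p - 1\<close>, through
  \<open>(x - g0) ^ (p - 1)\<close>, and the degree \<open>p - 2\<close>, through \<open>(x - g0) ^ (p - 1) - (x - g1) ^ (p - 1)\<close>.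
  The set of degrees is closed under addition and, below \<open>p\<close>, under subtraction of \<open>r\<close>.
  As \<open>2 * r \<le> p - 1\<close>, degrees can be added modulo \<open>r\<close> without leaving the range below \<open>p\<close>.
  The residues of \<open>p - 1\<close> and \<open>p - 2\<close> differ by 1, hence generate all residues, and degree 1 occurs
  (\<open>one_in_closed_set\<close>).

  What remains is that iterated refinement ends in a stable partition which still has the
  singletons \<open>{g0}\<close> and \<open>{g1}\<close> (\<open>CR_star_stable\<close>).
\<close>

section \<open>Power sums modulo a prime\<close>

text \<open>Summing \<open>(x + 1) ^ (k + 1) - x ^ (k + 1)\<close> over \<open>x < p\<close> telescopes to \<open>p ^ (k + 1)\<close>. Expanding
  binomially expresses \<open>k + 1\<close> times the \<open>k\<close>-th power sum through the lower ones, and \<open>k + 1\<close> is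
  invertible modulo \<open>p\<close>.\<close>

lemma prime_dvd_sum_powers:
  fixes p :: nat
  assumes "prime p" "k < p - 1"
  shows "int p dvd (\<Sum>x<p. int x ^ k)"
  using assms(2)
proof (induction k rule: less_induct)
  case (less k)
  define Q where "Q j = (\<Sum>x<p. int x ^ j)" for j
  have "int p ^ Suc k = (\<Sum>x<p. int (Suc x) ^ Suc k - int x ^ Suc k)"
    by (subst sum_lessThan_telescope) simp
  also have "\<dots> = (\<Sum>x<p. \<Sum>j\<le>k. int (Suc k choose j) * int x ^ j)"
  proof (rule sum.cong)
    fix x
    have "int (Suc x) ^ Suc k = (int x + 1) ^ Suc k" by (simp add: add.commute)
    also have "\<dots> = (\<Sum>j\<le>Suc k. int (Suc k choose j) * int x ^ j)"
      by (subst binomial_ring) simp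
    finally show "int (Suc x) ^ Suc k - int x ^ Suc k = (\<Sum>j\<le>k. int (Suc k choose j) * int x ^ j)"
      by simp
  qed simp
  also have "\<dots> = (\<Sum>j\<le>k. int (Suc k choose j) * Q j)"
    by (subst sum.swap) (simp add: Q_def sum_distrib_left)
  also have "\<dots> = (\<Sum>j<k. int (Suc k choose j) * Q j) + int (Suc k) * Q k"
    by (simp flip: lessThan_Suc_atMost)
  finally have "int (Suc k) * Q k = int p ^ Suc k - (\<Sum>j<k. int (Suc k choose j) * Q j)"
    by simp
  also have "int p dvd \<dots>"
    using less by (intro dvd_diff dvd_sum dvd_mult) (auto simp: Q_def)
  finally have "int p dvd int (Suc k) * Q k" .
  moreover have "\<not> int p dvd int (Suc k)"
    using less.prems by (auto simp only: int_dvd_int_iff dest!: dvd_imp_le)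
  ultimately show ?case
    using assms(1) by (simp add: prime_dvd_mult_iff Q_def)
qed

text \<open>Otherwise the sum over \<open>W\<close> of any polynomial of degree at most \<open>card W\<close> would reduce modulo \<open>p\<close> to
  \<open>card W\<close> times its constant term. Applied to the polynomial with root set \<open>W\<close>, this
  contradicts that its constant term and \<open>card W\<close> are invertible.\<close>

lemma ex_power_sum_not_dvd:
  fixes p :: nat and W :: "int set"
  assumes "prime p" "W \<subseteq> {0<..<int p}" "W \<noteq> {}"
  shows "\<exists>k\<ge>1. k \<le> card W \<and> \<not> int p dvd (\<Sum>w\<in>W. w ^ k)"
proof (rule ccontr)
  assume "\<not> ?thesis"
  then have dvd: "int p dvd (\<Sum>w\<in>W. w ^ k)" if "1 \<le> k" "k \<le> card W" for k
    using that by blast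
  have fin: "finite W" using assms(2) finite_subset by blast
  define q where "q = (\<Prod>w\<in>W. [:- w, 1:])"
  have deg: "degree q \<le> card W"
    unfolding q_def by (rule order_trans[OF degree_prod_sum_le]) (use fin in auto)
  have "poly q w = 0" if "w \<in> W" for w
    using that fin by (auto simp: q_def poly_prod)
  then have "0 = (\<Sum>w\<in>W. poly q w)" by simp
  also have "\<dots> = (\<Sum>i\<le>degree q. coeff q i * (\<Sum>w\<in>W. w ^ i))"
    unfolding poly_altdef by (subst sum.swap) (simp add: sum_distrib_left)
  also have "\<dots> = coeff q 0 * int (card W) + (\<Sum>i\<in>{1..degree q}. coeff q i * (\<Sum>w\<in>W. w ^ i))"
    by (simp add: atMost_atLeast0 sum.atLeast_Suc_atMost)
  finally have "coeff q 0 * int (card W) = - (\<Sum>i\<in>{1..degree q}. coeff q i * (\<Sum>w\<in>W. w ^ i))"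
    by simp
  also have "int p dvd \<dots>"
    unfolding dvd_minus_iff by (rule dvd_sum, rule dvd_mult, rule dvd) (use deg in auto)
  finally have "int p dvd coeff q 0 \<or> int p dvd int (card W)"
    using assms(1) by (simp add: prime_dvd_mult_iff)
  moreover have "\<not> int p dvd coeff q 0"
  proof
    assume "int p dvd coeff q 0"
    also have "coeff q 0 = (\<Prod>w\<in>W. - w)" by (simp add: q_def poly_prod flip: poly_0_coeff_0)
    finally obtain w where "w \<in> W" "int p dvd w"
      using assms(1) fin by (auto simp: prime_dvd_prod_iff)
    then show False using assms(2) zdvd_imp_le[of "int p" w] by force
  qed
  moreover have "\<not> int p dvd int (card W)"
  proof
    assume "int p dvd int (card W)"
    moreover have "card W > 0" using fin assms(3) by auto
    moreover have "card W \<le> card {0<..<int p}" by (intro card_mono assms) auto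
    ultimately show False using assms(1) by (auto dest!: dvd_imp_le simp: prime_gt_0_nat)
  qed
  ultimately show False by blast
qed

text \<open>The bound \<open>2 * k \<le> p - 1\<close> comes from applying the previous lemma to the smaller of \<open>U\<close> and its
  complement \<open>V\<close>; by \<open>prime_dvd_sum_powers\<close> their power sums add up to 0 modulo \<open>p\<close> in this range.\<close>

lemma ex_small_power_sum_not_dvd:
  fixes p :: nat and U :: "int set"
  assumes "prime p" "U \<subset> {0<..<int p}" "U \<noteq> {}"
  shows "\<exists>k\<ge>1. 2 * k \<le> p - 1 \<and> \<not> int p dvd (\<Sum>u\<in>U. u ^ k)"
proof -
  define V where "V = {0<..<int p} - U"
  have fin: "finite U" "finite V"
    using assms(2) finite_subset[of U "{0<..<int p}"] by (auto simp: V_def)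
  have cards: "card U + card V = p - 1"
    using card_Un_disjoint[OF fin] assms(2) by (auto simp: V_def Un_absorb1)
  show ?thesis
  proof (cases "card U \<le> card V")
    case True
    then show ?thesis
      using ex_power_sum_not_dvd[of p U] assms cards by force
  next
    case False
    have "V \<noteq> {}" "V \<subseteq> {0<..<int p}" using assms(2) by (auto simp: V_def)
    then obtain k where k: "k \<ge> 1" "k \<le> card V" "\<not> int p dvd (\<Sum>w\<in>V. w ^ k)"
      using ex_power_sum_not_dvd[of p V] assms(1) by blast
    have "{..<p} = insert 0 {0<..<p}"
      using assms(1) by (auto simp: prime_gt_0_nat)
    then have "(\<Sum>x<p. int x ^ k) = (\<Sum>x\<in>{0<..<p}. int x ^ k)"
      using k(1) by simp
    also have "\<dots> = (\<Sum>x\<in>{0<..<int p}. x ^ k)"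
      by (rule sum.reindex_bij_witness[of _ nat int]) auto
    also have "\<dots> = (\<Sum>x\<in>U. x ^ k) + (\<Sum>x\<in>V. x ^ k)"
      using assms(2) by (subst sum.union_disjoint[symmetric]) (auto simp: fin V_def Un_absorb1)
    finally have "int p dvd (\<Sum>x\<in>U. x ^ k) + (\<Sum>x\<in>V. x ^ k)"
      using prime_dvd_sum_powers[of p k] assms(1) k cards False by simp
    then have "\<not> int p dvd (\<Sum>x\<in>U. x ^ k)"
      using k(3) dvd_add_right_iff by blast
    then show ?thesis using k cards False by (intro exI[of _ k]) auto
  qed
qed

section \<open>Degrees of polynomials that respect a coloring\<close>

text \<open>Functions on \<open>\<int>/p\<close> are represented by integer polynomials read modulo \<open>p\<close>, and colorings of
  \<open>\<int>/p\<close> by functions on the integers, so that differences \<open>x - u\<close> need no reduction.\<close>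

definition color_constant :: "nat \<Rightarrow> (int \<Rightarrow> 'c) \<Rightarrow> int poly \<Rightarrow> bool" where
  "color_constant p \<kappa> f \<longleftrightarrow> (\<forall>x y. \<kappa> x = \<kappa> y \<longrightarrow> [poly f x = poly f y] (mod int p))"

text \<open>The degree of the reduction of \<open>f\<close> modulo \<open>p\<close>. The integer polynomial itself may have a larger
  degree. The degree is a relation because polynomials divisible by \<open>p\<close> have none.\<close>

definition degree_mod :: "nat \<Rightarrow> int poly \<Rightarrow> nat \<Rightarrow> bool" where
  "degree_mod p f d \<longleftrightarrow> \<not> int p dvd coeff f d \<and> (\<forall>i>d. int p dvd coeff f i)"

definition color_degrees :: "nat \<Rightarrow> (int \<Rightarrow> 'c) \<Rightarrow> nat set" where
  "color_degrees p \<kappa> = {d. \<exists>f. color_constant p \<kappa> f \<and> degree_mod p f d}"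

text \<open>Stability under color refinement in the Cayley graph of the integers.\<close>

definition equitable :: "int set \<Rightarrow> (int \<Rightarrow> 'c) \<Rightarrow> bool" where
  "equitable U \<kappa> \<longleftrightarrow> (\<forall>x y. \<kappa> x = \<kappa> y \<longrightarrow>
     image_mset (\<lambda>u. \<kappa> (x - u)) (mset_set U) = image_mset (\<lambda>u. \<kappa> (y - u)) (mset_set U))"

text \<open>Modulo \<open>p\<close>, the value of \<open>f\<close> is a function of the color, so the sum over the in-neighbors is
  determined by the multiset of their colors.\<close>

lemma color_constant_sum_shift:
  assumes "equitable U \<kappa>" "color_constant p \<kappa> f" "\<kappa> x = \<kappa> y"
  shows "[(\<Sum>u\<in>U. poly f (x - u)) = (\<Sum>u\<in>U. poly f (y - u))] (mod int p)"
proof -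
  \<comment> \<open>The value of \<open>f\<close> on color \<open>c\<close>; any representative of the color will do.\<close>
  define F where "F c = poly f (SOME z. \<kappa> z = c) mod int p" for c
  have F: "poly f z mod int p = F (\<kappa> z)" for z
  proof -
    have "\<kappa> (SOME z'. \<kappa> z' = \<kappa> z) = \<kappa> z" by (rule someI) simp
    then have "[poly f (SOME z'. \<kappa> z' = \<kappa> z) = poly f z] (mod int p)"
      using assms(2) unfolding color_constant_def by blast
    then show ?thesis by (simp add: F_def cong_def)
  qed
  have "(\<Sum>u\<in>U. poly f (z - u) mod int p)
      = \<Sum>\<^sub># (image_mset F (image_mset (\<lambda>u. \<kappa> (z - u)) (mset_set U)))" for z
    by (simp add: F sum_unfold_sum_mset image_mset.compositionality comp_def)
  moreover have "image_mset (\<lambda>u. \<kappa> (x - u)) (mset_set U) = image_mset (\<lambda>u. \<kappa> (y - u)) (mset_set U)"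
    using assms(1,3) unfolding equitable_def by blast
  ultimately have "(\<Sum>u\<in>U. poly f (x - u) mod int p) = (\<Sum>u\<in>U. poly f (y - u) mod int p)"
    by (simp only:)
  then show ?thesis unfolding cong_def by (metis mod_sum_eq)
qed

lemma color_degrees_add:
  assumes "prime p" "d \<in> color_degrees p \<kappa>" "e \<in> color_degrees p \<kappa>"
  shows "d + e \<in> color_degrees p \<kappa>"
proof -
  obtain f g where f: "color_constant p \<kappa> f" "degree_mod p f d"
    and g: "color_constant p \<kappa> g" "degree_mod p g e"
    using assms by (auto simp: color_degrees_def)
  have "color_constant p \<kappa> (f * g)"
    using f(1) g(1) by (auto simp: color_constant_def intro: cong_mult)
  moreover have "degree_mod p (f * g) (d + e)"
    unfolding degree_mod_def
  proof (intro conjI allI impI)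
    have "int p dvd (\<Sum>i\<in>{..d + e} - {d}. coeff f i * coeff g (d + e - i))"
    proof (rule dvd_sum)
      fix i assume i: "i \<in> {..d + e} - {d}"
      show "int p dvd coeff f i * coeff g (d + e - i)"
      proof (cases "i > d")
        case False
        then have "d + e - i > e" using i by auto
        then show ?thesis using g(2) by (simp add: degree_mod_def)
      qed (use f(2) in \<open>simp add: degree_mod_def\<close>)
    qed
    moreover have "\<not> int p dvd coeff f d * coeff g e"
      using f(2) g(2) assms(1) by (simp add: degree_mod_def prime_dvd_mult_iff)
    ultimately show "\<not> int p dvd coeff (f * g) (d + e)"
      by (simp add: coeff_mult sum.remove[of _ d] dvd_add_left_iff)
  next
    fix k assume k: "d + e < k"
    show "int p dvd coeff (f * g) k"
      unfolding coeff_mult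
    proof (rule dvd_sum)
      fix i
      show "int p dvd coeff f i * coeff g (k - i)"
      proof (cases "i > d")
        case False
        then have "k - i > e" using k by auto
        then show ?thesis using g(2) by (simp add: degree_mod_def)
      qed (use f(2) in \<open>simp add: degree_mod_def\<close>)
    qed
  qed
  ultimately show ?thesis by (auto simp: color_degrees_def)
qed

lemma zero_in_color_degrees:
  assumes "prime p"
  shows "0 \<in> color_degrees p \<kappa>"
proof -
  have "color_constant p \<kappa> 1" "degree_mod p 1 0"
    using assms by (auto simp: color_constant_def degree_mod_def)
  then show ?thesis by (auto simp: color_degrees_def)
qed

text \<open>The witness is \<open>\<Sum>u\<in>U. f (x - u)\<close> minus \<open>|U|\<close> times \<open>f\<close>. The monomial \<open>x ^ j\<close> contributes to its
  coefficient at \<open>x ^ i\<close>, for \<open>i < j\<close>, the number \<open>\<plusminus>(j choose i)\<close> times the power sum with exponent \<open>j - i\<close>.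
  So power sums that vanish for exponents below \<open>r\<close> leave the leading term of \<open>f\<close> as the only
  contribution at \<open>d - r\<close>, with the factor \<open>d choose (d - r)\<close>, which is invertible as \<open>d < p\<close>.\<close>

lemma color_degrees_lower:
  assumes "prime p" "equitable U \<kappa>" "d \<in> color_degrees p \<kappa>" "0 < r" "r \<le> d" "d < p"
    and lt: "\<And>k. 0 < k \<Longrightarrow> k < r \<Longrightarrow> int p dvd (\<Sum>u\<in>U. u ^ k)"
    and r: "\<not> int p dvd (\<Sum>u\<in>U. u ^ r)"
  shows "d - r \<in> color_degrees p \<kappa>"
proof -
  define P where "P k = (\<Sum>u\<in>U. u ^ k)" for k :: nat
  obtain f where f: "color_constant p \<kappa> f" "degree_mod p f d"
    using assms(3) by (auto simp: color_degrees_def)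
  \<comment> \<open>The image of the monomial of degree \<open>j\<close> under the operator, from which \<open>g\<close> arises by linearity.\<close>
  define h where "h j = (\<Sum>u\<in>U. [:- u, 1:] ^ j - [:0, 1:] ^ j)" for j :: nat
  define g where "g = (\<Sum>j\<le>degree f. smult (coeff f j) (h j))"
  have h: "coeff (h j) i =
      (if j \<le> i then 0 else int (j choose i) * (- 1) ^ (j - i) * P (j - i))" for i j
  proof -
    have "coeff ([:- u, 1:] ^ j - [:0, 1:] ^ j) i =
        (if j \<le> i then 0 else int (j choose i) * (- 1) ^ (j - i) * u ^ (j - i))" for u :: int
    proof (cases i j rule: linorder_cases)
      case less
      then show ?thesis
        by (simp add: coeff_linear_poly_power zero_power power_minus[of u])
    next
      case equal
      then show ?thesis by (simp add: coeff_linear_power)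
    next
      case greater
      then show ?thesis by (simp add: coeff_eq_0 degree_linear_power)
    qed
    then have "coeff (h j) i = (\<Sum>u\<in>U. if j \<le> i then 0
        else int (j choose i) * (- 1) ^ (j - i) * u ^ (j - i))"
      unfolding h_def coeff_sum by simp
    then show ?thesis by (simp add: P_def sum_distrib_left)
  qed
  have coeff_g: "coeff g i = (\<Sum>j\<le>degree f. coeff f j * coeff (h j) i)" for i
    by (simp add: g_def coeff_sum)
  \<comment> \<open>At or above \<open>d - r\<close>, only the pair \<open>(d, d - r)\<close> can contribute modulo \<open>p\<close>.\<close>
  have other: "int p dvd coeff f j * coeff (h j) i" if ij: "i \<ge> d - r" "j \<noteq> d \<or> i \<noteq> d - r" for i j
  proof -
    consider "j \<le> i" | "i < j" "j < i + r" | "j > d" using ij assms(4,5) by linarith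
    then show ?thesis
    proof cases
      case 2
      then show ?thesis using lt[of "j - i"] by (simp add: h P_def)
    qed (use f(2) in \<open>auto simp: h degree_mod_def\<close>)
  qed
  have "color_constant p \<kappa> g"
    unfolding color_constant_def
  proof (intro allI impI)
    fix x y assume xy: "\<kappa> x = \<kappa> y"
    have poly_g: "poly g z = (\<Sum>u\<in>U. poly f (z - u)) - int (card U) * poly f z" for z
    proof -
      have "poly g z = (\<Sum>j\<le>degree f. \<Sum>u\<in>U. coeff f j * (z - u) ^ j - coeff f j * z ^ j)"
        by (simp add: g_def h_def poly_sum sum_distrib_left right_diff_distrib)
      also have "\<dots> = (\<Sum>u\<in>U. \<Sum>j\<le>degree f. coeff f j * (z - u) ^ j - coeff f j * z ^ j)"
        by (rule sum.swap)
      finally show ?thesis by (simp add: poly_altdef sum_subtractf)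
    qed
    show "[poly g x = poly g y] (mod int p)"
      unfolding poly_g using xy f(1)
      by (intro cong_diff color_constant_sum_shift[OF assms(2) f(1)] cong_mult) (auto simp: color_constant_def)
  qed
  moreover have "degree_mod p g (d - r)"
    unfolding degree_mod_def
  proof (intro conjI allI impI)
    have "d \<le> degree f" using f(2) by (auto simp: degree_mod_def intro: le_degree)
    then have "coeff g (d - r) = coeff f d * coeff (h d) (d - r)
        + (\<Sum>j\<in>{..degree f} - {d}. coeff f j * coeff (h j) (d - r))"
      by (simp add: coeff_g sum.remove[of _ d])
    moreover have "int p dvd (\<Sum>j\<in>{..degree f} - {d}. coeff f j * coeff (h j) (d - r))"
      by (intro dvd_sum other) auto
    moreover have "\<not> int p dvd coeff f d * coeff (h d) (d - r)"
    proof -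
      have "\<not> p dvd d choose (d - r)"
      proof
        assume "p dvd d choose (d - r)"
        then have "p dvd fact (d - r) * fact (d - (d - r)) * (d choose (d - r))" by simp
        also have "\<dots> = fact d" by (rule binomial_fact_lemma) simp
        finally show False using assms(1,6) by (simp add: prime_dvd_fact_iff)
      qed
      moreover have "\<not> int p dvd (- 1) ^ r"
        using prime_dvd_power[of "int p" "- 1" r] prime_gt_1_nat[OF assms(1)] assms(1) by auto
      ultimately show ?thesis
        using assms(1,4,5) f(2) r by (simp add: h prime_dvd_mult_iff degree_mod_def P_def)
    qed
    ultimately show "\<not> int p dvd coeff g (d - r)"
      by (simp add: dvd_add_left_iff)
  next
    fix i assume "d - r < i"
    then show "int p dvd coeff g i"
      unfolding coeff_g by (intro dvd_sum other) auto
  qed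
  ultimately show ?thesis by (auto simp: color_degrees_def)
qed

text \<open>By Fermat's little theorem this polynomial is 0 on the class of \<open>g\<close> and 1 elsewhere.\<close>

lemma color_constant_singleton:
  assumes "prime p" and single: "\<And>x. \<kappa> x = \<kappa> g \<longleftrightarrow> [x = g] (mod int p)"
  shows "color_constant p \<kappa> ([:- g, 1:] ^ (p - 1))"
proof -
  have val: "[(x - g) ^ (p - 1) = (if \<kappa> x = \<kappa> g then 0 else 1)] (mod int p)" for x
  proof (cases "\<kappa> x = \<kappa> g")
    case True
    then have "int p dvd x - g" using single by (simp add: cong_iff_dvd_diff)
    moreover have "p - 1 > 0" using prime_gt_1_nat[OF assms(1)] by simp
    ultimately have "int p dvd (x - g) ^ (p - 1)" using assms(1) by (simp add: prime_dvd_power_iff)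
    then show ?thesis using True by (simp add: cong_0_iff)
  next
    case False
    define n where "n = nat ((x - g) mod int p)"
    have n: "int n = (x - g) mod int p"
      using assms(1) by (simp add: n_def prime_gt_0_nat)
    have "\<not> int p dvd x - g" using False single by (simp add: cong_iff_dvd_diff)
    then have "\<not> int p dvd int n" unfolding n by (simp add: dvd_mod_iff)
    then have "[n ^ (p - 1) = 1] (mod p)" using assms(1) by (intro fermat_theorem) auto
    then have "[int n ^ (p - 1) = 1] (mod int p)"
      by (metis cong_int_iff of_nat_1 of_nat_power)
    then show ?thesis using False unfolding n by (simp add: cong_def power_mod)
  qed
  show ?thesis
    unfolding color_constant_def
  proof (intro allI impI)
    fix x y assume "\<kappa> x = \<kappa> y"
    then have "[(x - g) ^ (p - 1) = (y - g) ^ (p - 1)] (mod int p)"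
      using val[of x] val[of y] by (auto intro: cong_trans cong_sym)
    then show "[poly ([:- g, 1:] ^ (p - 1)) x = poly ([:- g, 1:] ^ (p - 1)) y] (mod int p)"
      by simp
  qed
qed

lemma top_color_degree:
  assumes "prime p" "\<And>x. \<kappa> x = \<kappa> g \<longleftrightarrow> [x = g] (mod int p)"
  shows "p - 1 \<in> color_degrees p \<kappa>"
proof -
  have "degree_mod p ([:- g, 1:] ^ (p - 1)) (p - 1)"
    using assms(1) by (auto simp: degree_mod_def coeff_linear_power coeff_eq_0 degree_linear_power)
  then show ?thesis
    using color_constant_singleton[OF assms] by (auto simp: color_degrees_def)
qed

text \<open>The leading terms of \<open>(x - g0) ^ (p - 1)\<close> and \<open>(x - g1) ^ (p - 1)\<close> cancel, and the next coefficients
  differ by \<open>(p - 1) * (g1 - g0)\<close>, which is invertible.\<close>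

lemma second_color_degree:
  assumes "prime p" "2 < p"
    and g0: "\<And>x. \<kappa> x = \<kappa> g0 \<longleftrightarrow> [x = g0] (mod int p)"
    and g1: "\<And>x. \<kappa> x = \<kappa> g1 \<longleftrightarrow> [x = g1] (mod int p)"
    and "\<not> [g0 = g1] (mod int p)"
  shows "p - 2 \<in> color_degrees p \<kappa>"
proof -
  define f where "f = [:- g0, 1:] ^ (p - 1) - [:- g1, 1:] ^ (p - 1)"
  have "color_constant p \<kappa> f"
    using color_constant_singleton[of p \<kappa> g0, OF assms(1) g0]
      color_constant_singleton[of p \<kappa> g1, OF assms(1) g1]
    by (auto simp: color_constant_def f_def intro: cong_diff)
  moreover have "degree_mod p f (p - 2)"
    unfolding degree_mod_def
  proof (intro conjI allI impI)
    have "coeff ([:- g, 1:] ^ (p - 1)) (p - 2) = - (int (p - 1) * g)" for g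
    proof -
      have "p - 1 = Suc (p - 2)" using assms(2) by simp
      moreover have "coeff ([:- g, 1:] ^ Suc n) n = - (int (Suc n) * g)" for n
        by (subst coeff_linear_poly_power) simp_all
      ultimately show ?thesis by (simp only:)
    qed
    then have "coeff f (p - 2) = int (p - 1) * (g1 - g0)"
      by (simp add: f_def right_diff_distrib)
    moreover have "\<not> int p dvd int (p - 1)"
      using assms(2) by (auto simp only: int_dvd_int_iff dest!: dvd_imp_le)
    moreover have "\<not> int p dvd g1 - g0"
      using assms(5) by (simp add: cong_iff_dvd_diff dvd_diff_commute)
    ultimately show "\<not> int p dvd coeff f (p - 2)"
      using assms(1) by (simp add: prime_dvd_mult_iff)
  next
    fix i assume "p - 2 < i"
    then consider "i = p - 1" | "i > p - 1" by linarith
    then show "int p dvd coeff f i"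
      by cases (auto simp: f_def coeff_linear_power coeff_eq_0 degree_linear_power)
  qed
  ultimately show ?thesis by (auto simp: color_degrees_def)
qed

text \<open>Subtracting \<open>r\<close> repeatedly replaces an element below \<open>p\<close> by its residue modulo \<open>r\<close>. Two residues
  have a sum of at most \<open>2 * r - 2 < p\<close>, which can be reduced again, so the residues that lie in \<open>S\<close> form
  a subgroup of \<open>\<int>/r\<close>. It contains \<open>1 \<equiv> (p - 1) + (r - 1) * (p - 2)\<close>.\<close>

lemma one_in_closed_set:
  fixes p r :: nat
  assumes zero: "0 \<in> S" and add: "\<And>d e. d \<in> S \<Longrightarrow> e \<in> S \<Longrightarrow> d + e \<in> S"
    and lower: "\<And>d. d \<in> S \<Longrightarrow> r \<le> d \<Longrightarrow> d < p \<Longrightarrow> d - r \<in> S"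
    and top: "p - 1 \<in> S" "p - 2 \<in> S"
    and r: "0 < r" "2 * r \<le> p - 1"
  shows "1 \<in> S"
proof (cases "r = 1")
  \<comment> \<open>Here the residue of 1 is 0 and says nothing about 1, but subtracting \<open>r\<close> passes through 1.\<close>
  case True
  have "k < p - 1 \<Longrightarrow> p - 1 - k \<in> S" for k
  proof (induction k)
    case (Suc k)
    then show ?case using lower[of "p - 1 - k"] True by simp
  qed (use top in simp)
  from this[of "p - 2"] show ?thesis using r by (simp add: Suc_diff_Suc numeral_2_eq_2)
next
  case False
  have red: "d mod r \<in> S" if "d \<in> S" "d < p" for d
    using that
  proof (induction d rule: less_induct)
    case (less d)
    show ?case
    proof (cases "r \<le> d")
      case True
      then show ?thesis
        using less.IH[of "d - r"] less.prems lower[of d] r(1) by (simp add: le_mod_geq)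
    qed (use less.prems in simp)
  qed
  \<comment> \<open>This is where \<open>2 * r \<le> p - 1\<close> enters: the sum of two residues stays below \<open>p\<close>.\<close>
  have red_add: "(d + e) mod r \<in> S" if "d mod r \<in> S" "e mod r \<in> S" for d e
  proof -
    have "d mod r < r" "e mod r < r" using r(1) by simp_all
    then have "d mod r + e mod r < p" using r(2) by linarith
    then show ?thesis using red[OF add[OF that]] by (simp add: mod_add_eq)
  qed
  have "(n * (p - 2)) mod r \<in> S" for n
  proof (induction n)
    case (Suc n)
    have "p - 2 < p" using r by linarith
    then show ?case using red_add[OF red[OF top(2)] Suc.IH] by simp
  qed (use zero in simp)
  moreover have "(p - 1) mod r \<in> S" using red[OF top(1)] r by simp
  ultimately have "((r - 1) * (p - 2) + (p - 1)) mod r \<in> S"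
    by (rule red_add)
  moreover have "(r - 1) * (p - 2) + (p - 1) = 1 + r * (p - 2)"
  proof -
    have "(r - 1) * q + q = r * q" for q
      using r(1) by (cases r) simp_all
    from this[of "p - 2"] show ?thesis using r by presburger
  qed
  moreover have "(1 + r * (p - 2)) mod r = 1"
    using False r(1) mod_mult_self2[of 1 r "p - 2"] by simp
  ultimately show ?thesis by (simp only:)
qed

text \<open>A color-constant polynomial of degree 1 modulo \<open>p\<close> exists by the closure properties of the color
  degrees, and it separates residues, so points of equal color are congruent.\<close>

lemma equitable_two_singletons_imp_injective:
  assumes "prime p" "U \<subset> {0<..<int p}" "U \<noteq> {}" "equitable U \<kappa>"
    and g0: "\<And>x. \<kappa> x = \<kappa> g0 \<longleftrightarrow> [x = g0] (mod int p)"
    and g1: "\<And>x. \<kappa> x = \<kappa> g1 \<longleftrightarrow> [x = g1] (mod int p)"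
    and "\<not> [g0 = g1] (mod int p)"
    and "\<kappa> x = \<kappa> y"
  shows "[x = y] (mod int p)"
proof -
  \<comment> \<open>The bound is part of \<open>Q\<close>; its least witness is still the least exponent with a nonvanishing
    power sum, since smaller exponents satisfy the bound as well.\<close>
  define Q where "Q k \<longleftrightarrow> k \<ge> 1 \<and> 2 * k \<le> p - 1 \<and> \<not> int p dvd (\<Sum>u\<in>U. u ^ k)" for k
  define r where "r = (LEAST k. Q k)"
  have "Q r"
    unfolding r_def using ex_small_power_sum_not_dvd[OF assms(1-3)]
    by (intro LeastI_ex[of Q]) (auto simp: Q_def)
  then have r: "0 < r" "2 * r \<le> p - 1" "\<not> int p dvd (\<Sum>u\<in>U. u ^ r)"
    by (auto simp: Q_def)
  have lt: "int p dvd (\<Sum>u\<in>U. u ^ k)" if "0 < k" "k < r" for k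
  proof -
    have "\<not> Q k" using that(2) unfolding r_def by (rule not_less_Least)
    then show ?thesis using that r(2) by (simp add: Q_def)
  qed
  have "2 < p" using r by linarith
  have "1 \<in> color_degrees p \<kappa>"
  proof (rule one_in_closed_set[where p = p and r = r])
    show "p - 1 \<in> color_degrees p \<kappa>" by (rule top_color_degree[OF assms(1) g0])
    show "p - 2 \<in> color_degrees p \<kappa>"
      by (rule second_color_degree[OF assms(1) \<open>2 < p\<close> g0 g1 assms(7)])
    show "d - r \<in> color_degrees p \<kappa>" if "d \<in> color_degrees p \<kappa>" "r \<le> d" "d < p" for d
      by (rule color_degrees_lower[OF assms(1,4) that(1) r(1) that(2,3) lt r(3)])
  qed (fact zero_in_color_degrees[OF assms(1)] color_degrees_add[OF assms(1)] r)+
  then obtain f where f: "color_constant p \<kappa> f" "degree_mod p f 1"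
    by (auto simp: color_degrees_def)
  have "1 \<le> degree f" using f(2) by (intro le_degree) (auto simp: degree_mod_def)
  have "poly f x - poly f y = (\<Sum>i\<le>degree f. coeff f i * (x ^ i - y ^ i))"
    by (simp add: poly_altdef right_diff_distrib sum_subtractf)
  also have "\<dots> = coeff f 1 * (x - y) + (\<Sum>i\<in>{..degree f} - {1}. coeff f i * (x ^ i - y ^ i))"
    using \<open>1 \<le> degree f\<close> by (simp add: sum.remove[of _ 1])
  finally have "coeff f 1 * (x - y)
      = (poly f x - poly f y) - (\<Sum>i\<in>{..degree f} - {1}. coeff f i * (x ^ i - y ^ i))"
    by simp
  also have "int p dvd \<dots>"
  proof (rule dvd_diff)
    show "int p dvd poly f x - poly f y"
      using f(1) assms(8) by (simp add: color_constant_def cong_iff_dvd_diff)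
    show "int p dvd (\<Sum>i\<in>{..degree f} - {1}. coeff f i * (x ^ i - y ^ i))"
    proof (rule dvd_sum)
      fix i assume "i \<in> {..degree f} - {1}"
      then have "i = 0 \<or> i > 1" by auto
      then show "int p dvd coeff f i * (x ^ i - y ^ i)"
        using f(2) by (auto simp: degree_mod_def)
    qed
  qed
  finally show ?thesis
    using f(2) assms(1) by (simp add: prime_dvd_mult_iff degree_mod_def cong_iff_dvd_diff)
qed

section \<open>The stable partition\<close>

lemma cell_quotient:
  assumes "equiv A R" "x \<in> A"
  shows "cell (A // R) x = R `` {x}"
  unfolding cell_def
proof (rule the_equality)
  show "R `` {x} \<in> A // R \<and> x \<in> R `` {x}"
    using assms by (metis quotientI equiv_class_self)
next
  fix B assume "B \<in> A // R \<and> x \<in> B"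
  then show "B = R `` {x}"
    using assms by (metis equiv_class_self quotientI quotient_disj disjoint_iff)
qed

text \<open>The equivalence relation behind a partition \<open>D\<close> of \<open>A\<close>. Refinement acts on these relations by
  shrinking them, which makes termination and the preservation of singletons immediate. The
  equation \<open>A // same_cell A D = D\<close> expresses that \<open>D\<close> is a partition of \<open>A\<close>.\<close>

definition same_cell :: "'a set \<Rightarrow> 'a set set \<Rightarrow> 'a rel" where
  "same_cell A D = {(x, y). x \<in> A \<and> y \<in> A \<and> cell D x = cell D y}"

lemma same_cell_quotient:
  assumes "equiv A R"
  shows "same_cell A (A // R) = R"
proof -
  have "(x, y) \<in> same_cell A (A // R) \<longleftrightarrow> (x, y) \<in> R" for x y
    unfolding same_cell_def equiv_class_eq_iff[OF assms]
    by (auto simp: cell_quotient[OF assms])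
  then show ?thesis by auto
qed

lemma same_cell_subset: "same_cell A D \<subseteq> A \<times> A"
  by (auto simp: same_cell_def)

lemma CR_eq_quotient:
  fixes p U D
  defines "R \<equiv> {(x, y) \<in> same_cell (carrier (Zmod p)) D. in_colors p U D x = in_colors p U D y}"
  shows "CR p U D = carrier (Zmod p) // R" "equiv (carrier (Zmod p)) R"
    "same_cell (carrier (Zmod p)) (CR p U D) = R"
proof -
  show quot: "CR p U D = carrier (Zmod p) // R"
    unfolding CR_def R_def same_cell_def by (rule arg_cong[where f = "(//) _"]) auto
  show "equiv (carrier (Zmod p)) R"
    by (auto intro!: equivI refl_onI symI transI simp: R_def same_cell_def)
  then show "same_cell (carrier (Zmod p)) (CR p U D) = R"
    unfolding quot by (rule same_cell_quotient)
qed

text \<open>As long as the partition changes, the relation \<open>same_cell\<close> loses a pair. It is finite, so the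
  iteration stops, and it stops only at a fixed point of \<open>CR\<close>.\<close>

lemma CR_star_stable:
  fixes p :: nat and U :: "int set" and C :: "int set set"
  assumes C: "carrier (Zmod p) // same_cell (carrier (Zmod p)) C = C"
    and "finite (carrier (Zmod p))"
  defines "D \<equiv> CR_star p U C"
  shows "CR p U D = D" "carrier (Zmod p) // same_cell (carrier (Zmod p)) D = D"
    "same_cell (carrier (Zmod p)) D \<subseteq> same_cell (carrier (Zmod p)) C"
proof -
  let ?A = "carrier (Zmod p)"
  let ?inv = "\<lambda>D. ?A // same_cell ?A D = D \<and> same_cell ?A D \<subseteq> same_cell ?A C"
  have sub: "same_cell ?A (CR p U E) \<subseteq> same_cell ?A E" for E
    by (auto simp: CR_eq_quotient(3))
  have quot: "?A // same_cell ?A (CR p U E) = CR p U E" for E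
    by (simp add: CR_eq_quotient(3)) (simp add: CR_eq_quotient(1))
  have "CR p U D = D \<and> ?inv D"
    unfolding D_def CR_star_def
  proof (rule while_rule[where P = ?inv and r = "measure (\<lambda>E. card (same_cell ?A E))"])
    fix E assume E: "?inv E" "CR p U E \<noteq> E"
    then have "same_cell ?A (CR p U E) \<noteq> same_cell ?A E"
      using quot by metis
    moreover have "finite (same_cell ?A E)"
      using same_cell_subset[of ?A E] assms(2) finite_subset finite_SigmaI by metis
    ultimately show "(CR p U E, E) \<in> measure (\<lambda>E. card (same_cell ?A E))"
      using sub[of E] by (auto intro!: psubset_card_mono)
  next
    fix E assume "?inv E"
    then show "?inv (CR p U E)" using sub[of E] quot[of E] by blast
  qed (use C in auto)
  then show "CR p U D = D" "?A // same_cell ?A D = D" "same_cell ?A D \<subseteq> same_cell ?A C"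
    by auto
qed

text \<open>At a fixed point of \<open>CR\<close>, lying in one cell of \<open>D\<close> already entails equal in-neighbor colors.
  Reducing modulo \<open>p\<close> turns the coloring of residues into a periodic coloring of the integers.\<close>

lemma stable_imp_equitable:
  assumes "prime p" "U \<subseteq> carrier (Zmod p)" "CR p U D = D"
  shows "equitable U (\<lambda>x. cell D (x mod int p))"
proof -
  interpret residues "int p" "Zmod p"
    using prime_gt_1_nat[OF assms(1)] by unfold_locales auto
  have "finite U" using assms(2) by (rule finite_subset) simp
  have colors: "in_colors p U D (x mod int p)
      = image_mset (\<lambda>u. cell D ((x - u) mod int p)) (mset_set U)" for x
    unfolding in_colors_def
    by (rule image_mset_cong) (simp add: a_minus_def res_neg_eq res_add_eq mod_simps)
  have in_A: "x mod int p \<in> carrier (Zmod p)" for x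
    using prime_gt_0_nat[OF assms(1)] by (simp add: res_carrier_eq)
  show ?thesis
    unfolding equitable_def
  proof (intro allI impI)
    fix x y assume "cell D (x mod int p) = cell D (y mod int p)"
    then have "(x mod int p, y mod int p) \<in> same_cell (carrier (Zmod p)) D"
      using in_A by (simp add: same_cell_def)
    then have "(x mod int p, y mod int p) \<in> same_cell (carrier (Zmod p)) (CR p U D)"
      by (simp add: assms(3))
    then have "in_colors p U D (x mod int p) = in_colors p U D (y mod int p)"
      unfolding CR_eq_quotient(3) by simp
    then show "image_mset (\<lambda>u. cell D ((x - u) mod int p)) (mset_set U)
        = image_mset (\<lambda>u. cell D ((y - u) mod int p)) (mset_set U)"
      by (simp add: colors)
  qed
qed

text \<open>The third cell has to be nonempty: an empty set is never a class of an equivalence relation.\<close>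

lemma individualized_partition:
  assumes "g0 \<in> A" "g1 \<in> A" "g0 \<noteq> g1" "A - {g0, g1} \<noteq> {}"
  defines "C \<equiv> {{g0}, {g1}, A - {g0, g1}}"
  shows "A // same_cell A C = C"
    "\<And>x. (g0, x) \<in> same_cell A C \<Longrightarrow> x = g0"
    "\<And>x. (g1, x) \<in> same_cell A C \<Longrightarrow> x = g1"
proof -
  define R where "R = {(x, y) \<in> A \<times> A. (x = g0 \<longleftrightarrow> y = g0) \<and> (x = g1 \<longleftrightarrow> y = g1)}"
  have R: "equiv A R"
    by (auto intro!: equivI refl_onI symI transI simp: R_def)
  have cls: "R `` {g0} = {g0}" "R `` {g1} = {g1}"
    "\<And>x. x \<in> A - {g0, g1} \<Longrightarrow> R `` {x} = A - {g0, g1}"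
    using assms by (auto simp: R_def)
  have "A // R = C"
  proof (intro equalityI subsetI)
    fix X assume "X \<in> A // R"
    then obtain x where "x \<in> A" "X = R `` {x}" by (auto elim: quotientE)
    then show "X \<in> C" using cls by (cases "x \<in> {g0, g1}") (auto simp: C_def)
  next
    fix X assume "X \<in> C"
    moreover obtain z where "z \<in> A - {g0, g1}" using assms(4) by auto
    ultimately obtain x where "x \<in> A" "X = R `` {x}"
      using assms(1,2) cls unfolding C_def by blast
    then show "X \<in> A // R" by (simp add: quotientI)
  qed
  moreover from this have "same_cell A C = R" using same_cell_quotient[OF R] by simp
  ultimately show "A // same_cell A C = C"
    "\<And>x. (g0, x) \<in> same_cell A C \<Longrightarrow> x = g0" "\<And>x. (g1, x) \<in> same_cell A C \<Longrightarrow> x = g1"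
    by (auto simp: R_def)
qed

theorem lemma39:
  fixes p :: nat and U :: "int set" and g0 g1 :: int
  assumes "prime p"
    and "U \<noteq> {}"
    and "U \<subseteq> carrier (Zmod p) - {\<zero>\<^bsub>Zmod p\<^esub>}"
    and "U \<noteq> carrier (Zmod p) - {\<zero>\<^bsub>Zmod p\<^esub>}"
    and "g0 \<in> carrier (Zmod p)"
    and "g1 \<in> carrier (Zmod p)"
    and "g0 \<noteq> g1"
  shows "CR_star p U {{g0}, {g1}, carrier (Zmod p) - {g0, g1}} = {{g} | g. g \<in> carrier (Zmod p)}"
proof -
  interpret residues "int p" "Zmod p"
    using prime_gt_1_nat[OF assms(1)] by unfold_locales auto
  let ?A = "carrier (Zmod p)"
  define C where "C = {{g0}, {g1}, ?A - {g0, g1}}"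
  define D where "D = CR_star p U C"
  define \<kappa> where "\<kappa> x = cell D (x mod int p)" for x
  have A: "?A = {0..<int p}" by (subst res_carrier_eq) auto
  have nonzero: "?A - {\<zero>\<^bsub>Zmod p\<^esub>} = {0<..<int p}" by (auto simp: A res_zero_eq)
  then have U: "U \<subset> {0<..<int p}" using assms(3,4) by auto
  \<comment> \<open>A nonempty proper subset of the nonzero residues forces \<open>p > 2\<close>, so a third vertex exists.\<close>
  have "card {g0, g1} < card ?A"
  proof -
    have "card U < card {0<..<int p}" using U by (intro psubset_card_mono) auto
    moreover have "card U > 0" using U assms(2) finite_subset[of U "{0<..<int p}"] by (auto simp: card_gt_0_iff)
    ultimately show ?thesis using assms(7) by (simp add: A)
  qed
  then have rest: "?A - {g0, g1} \<noteq> {}"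
    using card_mono[of "{g0, g1}" ?A] by (metis Diff_eq_empty_iff finite.emptyI finite.insertI leD)
  note C = individualized_partition[OF assms(5-7) rest, folded C_def]
  have "finite ?A" by (simp add: A)
  note D = CR_star_stable[OF C(1) this, of U, folded D_def]
  have in_A: "x mod int p \<in> ?A" for x using prime_gt_0_nat[OF assms(1)] by (simp add: A)
  have single: "\<kappa> x = \<kappa> g \<longleftrightarrow> [x = g] (mod int p)"
    if "g \<in> ?A" and g: "\<And>y. (g, y) \<in> same_cell ?A C \<Longrightarrow> y = g" for x g
  proof
    have mod: "g mod int p = g" using that(1) by (simp add: A)
    assume "\<kappa> x = \<kappa> g"
    then have "(g, x mod int p) \<in> same_cell ?A D"
      using that(1) in_A by (simp add: same_cell_def \<kappa>_def mod)
    then have "x mod int p = g" using D(3) g by blast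
    then show "[x = g] (mod int p)" by (simp add: cong_def mod)
  qed (simp add: \<kappa>_def cong_def)
  have "equitable U \<kappa>"
    unfolding \<kappa>_def using assms(1,3) D(1) by (intro stable_imp_equitable) auto
  moreover have "\<not> [g0 = g1] (mod int p)"
    using assms(5-7) by (simp add: A cong_def)
  ultimately have inj: "[x = y] (mod int p)" if "\<kappa> x = \<kappa> y" for x y
    using equitable_two_singletons_imp_injective[OF assms(1) U assms(2) _
        single[OF assms(5) C(2)] single[OF assms(6) C(3)] _ that]
    by blast
  have "same_cell ?A D = Id_on ?A"
  proof (intro equalityI subrelI)
    fix x y assume "(x, y) \<in> same_cell ?A D"
    then show "(x, y) \<in> Id_on ?A"
      using inj[of x y] by (auto simp: same_cell_def \<kappa>_def A cong_def)
  qed (auto simp: same_cell_def)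
  then have "D = ?A // Id_on ?A" using D(2) by simp
  also have "\<dots> = {{g} | g. g \<in> ?A}" by (auto simp: quotient_def Id_on_def)
  finally show ?thesis by (simp add: D_def C_def)
qed

end
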